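(* Let $B>0$, $x\in\mathbb{R}$ and let $\omega$ be a modulus-bounding function. Let $C>0$ be a constant such that $\left|\frac2\pi\int_0^\xi D_n^*(t)\,dt\right|\le C$ for all $\xi\in[0,\pi]$ and all $n\in\mathbb{N}$. Then for all $f\in\mathscr{BV}_1(B,x,\omega)$ and each $\delta\in(0,\pi]$ we have $$\left|\mathscr{S}_nf(x)-\frac12\big(f(x+0)+f(x-0)\big)\right|\le\frac{2B}{\pi n}\left(1+6\cot\left(\frac\delta2\right)\right)+8C\,\omega(\delta),\qquad n\in\mathbb{N}.$$
   Context: A modulus-bounding function is a non-decreasing function $\omega:[0,\infty)\to[0,\infty)$ (no limit condition at $0$ is required). $V_\alpha^\beta(f)$ denotes the total variation of $f$ on $[\alpha,\beta]$, and $v_f$ is the variation function, so that $v_f(\beta)-v_f(\alpha)=V_\alpha^\beta(f)$ for $\alpha<\beta$; for a $2\pi$-periodic $f$ and a point $x\in\mathbb{R}$ it is taken on any compact interval whose interior contains $[x-\pi,x+\pi]$ (the quantities below do not depend on the choice). For a real function $g$ of bounded variation, the left and right local quasi-moduli at $x$ are, for $0<\delta\le\pi$, $\varpi^-(g,x,\delta)=\sup\{|g(x-0)-g(t)|:\ t\in[x-\delta,x)\}$ and $\varpi^+(g,x,\delta)=\sup\{|g(x+0)-g(t)|:\ t\in(x,x+\delta]\}$, where $g(x\mp0)$ are the one-sided limits. $\mathscr{BV}_1(B,x,\omega)$ is the class of all $2\pi$-periodic functions $f:\mathbb{R}\to\mathbb{R}$ satisfying $V_{-\pi}^{\pi}(f)\le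 B$, $\varpi^-(v_f,x,\delta)\le\omega(\delta)$ and $\varpi^+(v_f,x,\delta)\le\omega(\delta)$ for all $0<\delta\le\pi$. The Dirichlet kernel is $D_n(x)=\frac12+\sum_{k=1}^n\cos kx$, the modified Dirichlet kernel is $D_n^*(x)=\frac12+\sum_{k=1}^{n-1}\cos kx+\frac12\cos nx$, and $\mathscr{S}_nf(x)=\frac1\pi\int_{-\pi}^{\pi}D_n(x-t)f(t)\,dt$ is the $n$-th partial sum of the Fourier series of $f$. *)

theory Defs
  imports "HOL-Analysis.Analysis"
begin

text \<open>A function on \<open>[0,\<infinity>)\<close> is rendered as a total function on the reals whose values at
  negative arguments are irrelevant.\<close>

definition modulus_bounding :: "(real \<Rightarrow> real) \<Rightarrow> bool" where
  "modulus_bounding \<omega> \<longleftrightarrow> mono_on {0..} \<omega> \<and> (\<forall>t\<ge>0. 0 \<le> \<omega> t)"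

text \<open>The total variation is extended-real valued, so that a bound \<open>total_variation f a b \<le> ereal B\<close>
  includes the assertion that \<open>f\<close> has bounded variation on \<open>[a,b]\<close>. It is meant for \<open>a \<le> b\<close>.
  Repeated partition points are allowed; they contribute zero.\<close>

definition total_variation :: "(real \<Rightarrow> real) \<Rightarrow> real \<Rightarrow> real \<Rightarrow> ereal" where
  "total_variation f a b =
     Sup {ereal (\<Sum>i<m. \<bar>f (p (Suc i)) - f (p i)\<bar>) | (p :: nat \<Rightarrow> real) m.
            p 0 = a \<and> p m = b \<and> (\<forall>i<m. p i \<le> p (Suc i))}"

text \<open>The variation function with base point \<open>a\<close>, meant for \<open>t \<ge> a\<close> and \<open>f\<close> of bounded variation
  on compact intervals. Another base point changes it by an additive constant only.\<close>

definition variation_function :: "(real \<Rightarrow> real) \<Rightarrow> real \<Rightarrow> real \<Rightarrow> real" where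
  "variation_function f a t = real_of_ereal (total_variation f a t)"

text \<open>The local quasi-moduli are meant for \<open>\<delta> > 0\<close> and \<open>g\<close> of bounded variation near \<open>x\<close>; then the
  one-sided limits exist and the suprema are over nonempty bounded sets.\<close>

definition left_quasi_modulus :: "(real \<Rightarrow> real) \<Rightarrow> real \<Rightarrow> real \<Rightarrow> real" where
  "left_quasi_modulus g x \<delta> = (SUP t\<in>{x - \<delta>..<x}. \<bar>Lim (at_left x) g - g t\<bar>)"

definition right_quasi_modulus :: "(real \<Rightarrow> real) \<Rightarrow> real \<Rightarrow> real \<Rightarrow> real" where
  "right_quasi_modulus g x \<delta> = (SUP t\<in>{x<..x + \<delta>}. \<bar>Lim (at_right x) g - g t\<bar>)"

text \<open>The variation function is taken on \<open>[x - 2\<pi>, x + 2\<pi>]\<close>, an interval whose interior contains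
  \<open>[x - \<pi>, x + \<pi>]\<close>; the quasi-moduli do not depend on this choice. The bound on the variation over
  one period makes it finite there.\<close>

definition BV1 :: "real \<Rightarrow> real \<Rightarrow> (real \<Rightarrow> real) \<Rightarrow> (real \<Rightarrow> real) set" where
  "BV1 B x \<omega> = {f. (\<forall>t. f (t + 2 * pi) = f t)
     \<and> total_variation f (- pi) pi \<le> ereal B
     \<and> (\<forall>\<delta>. 0 < \<delta> \<and> \<delta> \<le> pi \<longrightarrow>
           left_quasi_modulus (variation_function f (x - 2 * pi)) x \<delta> \<le> \<omega> \<delta>
         \<and> right_quasi_modulus (variation_function f (x - 2 * pi)) x \<delta> \<le> \<omega> \<delta>)}"

definition dirichlet_kernel :: "nat \<Rightarrow> real \<Rightarrow> real" where
  "dirichlet_kernel n t = 1 / 2 + (\<Sum>k=1..n. cos (real k * t))"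

definition modified_dirichlet_kernel :: "nat \<Rightarrow> real \<Rightarrow> real" where
  "modified_dirichlet_kernel n t =
     1 / 2 + (\<Sum>k=1..<n. cos (real k * t)) + 1 / 2 * cos (real n * t)"

definition fourier_partial_sum :: "nat \<Rightarrow> (real \<Rightarrow> real) \<Rightarrow> real \<Rightarrow> real" where
  "fourier_partial_sum n f x =
     1 / pi * integral {- pi..pi} (\<lambda>t. dirichlet_kernel n (x - t) * f t)"

end

theory Submission
  imports Defs "HOL-Library.Periodic_Fun"
begin

text \<open>The increasing functions \<open>u = (v + f)/2\<close> and \<open>w = (v - f)/2\<close>, where \<open>v\<close> is the variation function,
  satisfy \<open>f = u - w\<close> and \<open>v = u + w\<close>; so it suffices to estimate \<open>\<integral>\<^sub>0\<^sup>\<pi> h D\<^sub>n\<close> for increasing \<open>h\<close>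
  with \<open>h(0) = 0\<close>, namely the increments of \<open>u\<close> and \<open>w\<close> on either side of \<open>x\<close>. Write
  \<open>D\<^sub>n(t) = D\<^sub>n\<^sup>*(t) + cos(nt)/2\<close> with \<open>D\<^sub>n\<^sup>*(t) = sin(nt) cot(t/2)/2\<close>. By the second mean value theorem
  the part over \<open>[0,\<delta>]\<close> is at most \<open>C \<pi> h(\<delta>)\<close>, the part over \<open>[\<delta>,\<pi>]\<close> is at most
  \<open>h(\<pi>) cot(\<delta>/2)/n\<close>, and the cosine contributes at most \<open>h(\<pi>)/(2n)\<close>. Summing over \<open>u\<close>, \<open>w\<close> and both
  sides, the values \<open>h(\<delta>)\<close> add up to at most \<open>2 \<omega>(\<delta>)\<close> and the values \<open>h(\<pi>)\<close> to at most \<open>B\<close>.\<close>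

subsection \<open>Total variation\<close>

text \<open>The window from \<open>c\<close> to \<open>c + p\<close> is cut at \<open>a + p\<close>,
  and its outer piece is moved back to [a, c] by periodicity. Working in a semigroup, without
  cancellation, covers both the extended-real total variation and the integral of a periodic
  function.\<close>

lemma periodic_additive_interval_function:
  fixes Q :: "real \<Rightarrow> real \<Rightarrow> 'a::ab_semigroup_add"
  assumes add: "\<And>a b c. a \<le> b \<Longrightarrow> b \<le> c \<Longrightarrow> Q a c = Q a b + Q b c"
    and per: "\<And>a b. Q (a + p) (b + p) = Q a b"
    and "p > 0"
  shows "Q a (a + p) = Q b (b + p)"
proof -
  interpret periodic_fun_simple "\<lambda>b. Q b (b + p)" p
    by standard (rule per)
  \<comment> \<open>Move \<open>b\<close> into the window \<open>[a, a + p]\<close> by a multiple of \<open>p\<close>.\<close>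
  define c where "c = b + of_int \<lceil>(a - b) / p\<rceil> * p"
  have "(a - b) / p \<le> of_int \<lceil>(a - b) / p\<rceil>" "of_int \<lceil>(a - b) / p\<rceil> \<le> (a - b) / p + 1"
    by linarith+
  then have "(a - b) / p * p \<le> of_int \<lceil>(a - b) / p\<rceil> * p"
    "of_int \<lceil>(a - b) / p\<rceil> * p \<le> ((a - b) / p + 1) * p"
    using \<open>p > 0\<close> by (intro mult_right_mono; simp)+
  then have c: "a \<le> c" "c \<le> a + p"
    using \<open>p > 0\<close> by (simp_all add: c_def distrib_right)
  have "Q b (b + p) = Q c (c + p)"
    unfolding c_def by (rule plus_of_int[symmetric])
  also have "\<dots> = Q c (a + p) + Q (a + p) (c + p)"
    using c by (intro add) auto
  also have "\<dots> = Q a c + Q c (a + p)"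
    by (simp add: per add.commute)
  also have "\<dots> = Q a (a + p)"
    using c by (intro add[symmetric])
  finally show ?thesis by simp
qed

lemma sum_le_total_variation:
  assumes "p 0 = a" "p m = b" "\<And>i. i < m \<Longrightarrow> p i \<le> p (Suc i)"
  shows "ereal (\<Sum>i<m. \<bar>f (p (Suc i)) - f (p i)\<bar>) \<le> total_variation f a b"
  unfolding total_variation_def using assms by (intro Sup_upper) auto

lemma total_variation_leI:
  assumes "\<And>p m. p 0 = a \<Longrightarrow> p m = b \<Longrightarrow> (\<And>i. i < m \<Longrightarrow> p i \<le> p (Suc i)) \<Longrightarrow>
             ereal (\<Sum>i<m. \<bar>f (p (Suc i)) - f (p i)\<bar>) \<le> K"
  shows "total_variation f a b \<le> K"
  unfolding total_variation_def by (rule Sup_least) (use assms in auto)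

lemma abs_diff_le_total_variation:
  assumes "a \<le> b"
  shows "ereal \<bar>f b - f a\<bar> \<le> total_variation f a b"
  using sum_le_total_variation[of "\<lambda>i. if i = 0 then a else b" a 1 b f] assms by simp

lemma total_variation_nonneg: "a \<le> b \<Longrightarrow> 0 \<le> total_variation f a b"
  using abs_diff_le_total_variation[of a b f] order_trans[of 0 "ereal \<bar>f b - f a\<bar>"] by simp

lemma total_variation_shift:
  "total_variation f (a + c) (b + c) = total_variation (\<lambda>t. f (t + c)) a b"
proof (rule antisym)
  show "total_variation f (a + c) (b + c) \<le> total_variation (\<lambda>t. f (t + c)) a b"
  proof (rule total_variation_leI)
    fix p :: "nat \<Rightarrow> real" and m
    assume "p 0 = a + c" "p m = b + c" "\<And>i. i < m \<Longrightarrow> p i \<le> p (Suc i)"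
    then show "ereal (\<Sum>i<m. \<bar>f (p (Suc i)) - f (p i)\<bar>) \<le> total_variation (\<lambda>t. f (t + c)) a b"
      using sum_le_total_variation[of "\<lambda>i. p i - c" a m b "\<lambda>t. f (t + c)"] by simp
  qed
  show "total_variation (\<lambda>t. f (t + c)) a b \<le> total_variation f (a + c) (b + c)"
  proof (rule total_variation_leI)
    fix p :: "nat \<Rightarrow> real" and m
    assume "p 0 = a" "p m = b" "\<And>i. i < m \<Longrightarrow> p i \<le> p (Suc i)"
    then show "ereal (\<Sum>i<m. \<bar>f (p (Suc i) + c) - f (p i + c)\<bar>) \<le> total_variation f (a + c) (b + c)"
      using sum_le_total_variation[of "\<lambda>i. p i + c" "a + c" m "b + c" f] by simp
  qed
qed

lemma total_variation_le_add:
  assumes "a \<le> b" "b \<le> c"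
  shows "total_variation f a c \<le> total_variation f a b + total_variation f b c"
proof (rule total_variation_leI)
  \<comment> \<open>A partition of \<open>[a,c]\<close> is clipped at \<open>b\<close> from above and from below; no refinement is needed since
    repeated points are allowed.\<close>
  fix p :: "nat \<Rightarrow> real" and m
  assume p: "p 0 = a" "p m = c" and mono: "\<And>i. i < m \<Longrightarrow> p i \<le> p (Suc i)"
  define l r where "l i = min (p i) b" and "r i = max (p i) b" for i
  have "\<bar>f (p (Suc i)) - f (p i)\<bar> \<le> \<bar>f (l (Suc i)) - f (l i)\<bar> + \<bar>f (r (Suc i)) - f (r i)\<bar>"
    if "i < m" for i
    using mono[OF that] by (auto simp: l_def r_def min_def max_def)
  then have "(\<Sum>i<m. \<bar>f (p (Suc i)) - f (p i)\<bar>)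
      \<le> (\<Sum>i<m. \<bar>f (l (Suc i)) - f (l i)\<bar>) + (\<Sum>i<m. \<bar>f (r (Suc i)) - f (r i)\<bar>)"
    by (subst sum.distrib[symmetric]) (rule sum_mono, simp)
  then have "ereal (\<Sum>i<m. \<bar>f (p (Suc i)) - f (p i)\<bar>)
      \<le> ereal (\<Sum>i<m. \<bar>f (l (Suc i)) - f (l i)\<bar>) + ereal (\<Sum>i<m. \<bar>f (r (Suc i)) - f (r i)\<bar>)"
    by simp
  also have "\<dots> \<le> total_variation f a b + total_variation f b c"
    using p assms mono
    by (intro add_mono sum_le_total_variation) (auto simp: l_def r_def min_def max_def intro: order_trans)
  finally show "ereal (\<Sum>i<m. \<bar>f (p (Suc i)) - f (p i)\<bar>) \<le> total_variation f a b + total_variation f b c" .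
qed

text \<open>The two partitions are concatenated. Since \<open>p m = b = q 0\<close>, the glued
  sequence can be read at index \<open>m\<close> from either side, so the two sums add with no extra
  term.\<close>

lemma partition_sums_add_le_total_variation:
  assumes p: "p 0 = a" "p m = b" "\<And>i. i < m \<Longrightarrow> p i \<le> p (Suc i)"
    and q: "q 0 = b" "q k = c" "\<And>i. i < k \<Longrightarrow> q i \<le> q (Suc i)"
  shows "ereal (\<Sum>i<m. \<bar>f (p (Suc i)) - f (p i)\<bar>) + ereal (\<Sum>i<k. \<bar>f (q (Suc i)) - f (q i)\<bar>)
           \<le> total_variation f a c"
proof -
  define r where "r i = (if i \<le> m then p i else q (i - m))" for i
  have r1: "r i = p i" if "i \<le> m" for i using that by (simp add: r_def)
  have r2: "r (i + m) = q i" for i using p(2) q(1) by (simp add: r_def)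
  have "(\<Sum>i<m + k. \<bar>f (r (Suc i)) - f (r i)\<bar>)
      = (\<Sum>i<m. \<bar>f (r (Suc i)) - f (r i)\<bar>) + (\<Sum>i<k. \<bar>f (r (Suc (i + m))) - f (r (i + m))\<bar>)"
    by (induction k) (simp_all add: add_ac)
  also have "\<dots> = (\<Sum>i<m. \<bar>f (p (Suc i)) - f (p i)\<bar>) + (\<Sum>i<k. \<bar>f (q (Suc i)) - f (q i)\<bar>)"
    using r2[of "Suc _"] by (intro arg_cong2[where f = "(+)"] sum.cong) (auto simp: r1 r2)
  finally have eq: "(\<Sum>i<m + k. \<bar>f (r (Suc i)) - f (r i)\<bar>)
    = (\<Sum>i<m. \<bar>f (p (Suc i)) - f (p i)\<bar>) + (\<Sum>i<k. \<bar>f (q (Suc i)) - f (q i)\<bar>)" .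
  have "r i \<le> r (Suc i)" if "i < m + k" for i
  proof (cases "i < m")
    case False
    then have "i = (i - m) + m" "i - m < k" using that by auto
    then show ?thesis using q(3)[of "i - m"] r2[of "i - m"] r2[of "Suc (i - m)"] by simp
  qed (use p(3) in \<open>simp add: r1\<close>)
  then have "ereal (\<Sum>i<m + k. \<bar>f (r (Suc i)) - f (r i)\<bar>) \<le> total_variation f a c"
    using r1[of 0] r2[of k] p q by (intro sum_le_total_variation) (auto simp: add.commute)
  then show ?thesis by (simp add: eq)
qed

lemma total_variation_add:
  assumes "a \<le> b" "b \<le> c"
  shows "total_variation f a c = total_variation f a b + total_variation f b c"
proof (rule antisym)
  show "total_variation f a c \<le> total_variation f a b + total_variation f b c"
    using assms by (rule total_variation_le_add)
  let ?V = "total_variation f"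
  let ?s = "\<lambda>p m. ereal (\<Sum>i<m. \<bar>f (p (Suc i)) - f (p i)\<bar>)"
  \<comment> \<open>The suprema are taken one at a time. A partition sum is finite, so it may be
    subtracted in the extended reals while the supremum over partitions of [b, c] is formed.\<close>
  have *: "?s p m + ?V b c \<le> ?V a c"
    if "p 0 = a" "p m = b" "\<And>i. i < m \<Longrightarrow> p i \<le> p (Suc i)" for p m
  proof -
    have "?V b c \<le> ?V a c - ?s p m"
    proof (rule total_variation_leI)
      fix q :: "nat \<Rightarrow> real" and k
      assume q: "q 0 = b" "q k = c" "\<And>i. i < k \<Longrightarrow> q i \<le> q (Suc i)"
      have "?s p m + ?s q k \<le> ?V a c"
        using that q by (rule partition_sums_add_le_total_variation)
      then show "?s q k \<le> ?V a c - ?s p m"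
        by (simp add: ereal_le_minus add.commute)
    qed
    then show ?thesis by (simp add: ereal_le_minus add.commute)
  qed
  show "?V a b + ?V b c \<le> ?V a c"
  \<comment> \<open>The second supremum requires subtracting \<open>?V b c\<close>, hence its
    finiteness. If it is infinite, the one-step partition of [a, b] already forces
    \<open>?V a c\<close> to be infinite.\<close>
  proof (cases "?V b c = \<infinity>")
    case True
    then show ?thesis
      using *[of "\<lambda>i. if i = 0 then a else b" 1] assms total_variation_nonneg[of a b f] by auto
  next
    case False
    then have fin: "\<bar>?V b c\<bar> \<noteq> \<infinity>"
      using total_variation_nonneg[OF assms(2), of f] by auto
    have "?V a b \<le> ?V a c - ?V b c"
      by (rule total_variation_leI) (use * fin in \<open>auto simp: ereal_le_minus\<close>)
    then show ?thesis using fin by (simp add: ereal_le_minus)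
  qed
qed

context
  fixes f :: "real \<Rightarrow> real" and p :: real
  assumes per: "\<And>t. f (t + p) = f t" and p: "p > 0"
begin

lemma total_variation_period: "total_variation f a (a + p) = total_variation f b (b + p)"
  by (rule periodic_additive_interval_function)
    (erule (1) total_variation_add, simp_all add: total_variation_shift per p)

text \<open>Finitely many consecutive periods starting at \<open>a\<close> cover [a, b], and each
  has the same variation as the period starting at \<open>c\<close>.\<close>

lemma total_variation_periodic_finite:
  assumes "total_variation f c (c + p) < \<infinity>" "a \<le> b"
  shows "total_variation f a b < \<infinity>"
proof -
  have fin: "total_variation f a (a + real n * p) < \<infinity>" for n
  proof (induction n)
    case 0
    have "total_variation f a a \<le> total_variation f a (a + p)"
      using total_variation_add[of a a "a + p" f] ereal_le_add_self[OF total_variation_nonneg[of a "a + p" f]] p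
      by (metis less_eq_real_def less_add_same_cancel1)
    then show ?case using assms(1) total_variation_period[of a c] by (auto intro: le_less_trans)
  next
    case (Suc n)
    have "total_variation f a (a + real (Suc n) * p) = total_variation f a (a + real n * p)
       + total_variation f (a + real n * p) (a + real n * p + p)"
      using p by (subst total_variation_add[symmetric]) (auto simp: algebra_simps)
    then show ?case using Suc assms(1) total_variation_period[of "a + real n * p" c] by simp
  qed
  obtain n :: nat where "(b - a) / p < n" using reals_Archimedean2 by blast
  then have "b \<le> a + real n * p" using p by (simp add: field_simps)
  then have "total_variation f a b \<le> total_variation f a (a + real n * p)"
    using assms(2) total_variation_nonneg[of b "a + real n * p" f]
    by (subst total_variation_add[of a b]) (auto simp: ereal_le_add_self)
  then show ?thesis using fin[of n] by (rule le_less_trans)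
qed

end

subsection \<open>Integrals against increasing functions\<close>

text \<open>The full form of the second mean value theorem produces the integral of the product, so
  integrability comes with it.\<close>

lemma increasing_times_integrable:
  fixes g K :: "real \<Rightarrow> real"
  assumes "K integrable_on {a..b}" "mono_on {a..b} g"
  shows "(\<lambda>t. g t * K t) integrable_on {a..b}"
proof (cases "a \<le> b")
  case True
  show ?thesis
    by (rule second_mean_value_theorem_full[OF assms(1) True, of g])
      (auto intro: mono_onD[OF assms(2)])
qed (simp add: integrable_on_empty)

text \<open>The mean value formula is rearranged by splitting at \<open>c\<close>: the integrals
  over [a, b] and [c, b] get the weights \<open>g a\<close> and \<open>g b - g a\<close>. These are
  nonnegative and add up to \<open>g b\<close>, and both integrals end at \<open>b\<close>, so
  \<open>M\<close> bounds them.\<close>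

lemma integral_increasing_times_bound:
  fixes g K :: "real \<Rightarrow> real"
  assumes K: "K integrable_on {a..b}" and "a \<le> b" and g: "mono_on {a..b} g" and "0 \<le> g a"
    and M: "\<And>c. a \<le> c \<Longrightarrow> c \<le> b \<Longrightarrow> \<bar>integral {c..b} K\<bar> \<le> M"
  shows "\<bar>integral {a..b} (\<lambda>t. g t * K t)\<bar> \<le> g b * M"
proof -
  obtain c where c: "c \<in> {a..b}"
    and eq: "integral {a..b} (\<lambda>t. g t * K t) = g a * integral {a..c} K + g b * integral {c..b} K"
    using second_mean_value_theorem[OF K \<open>a \<le> b\<close>, of g] g by (auto simp: mono_on_def)
  have "g a \<le> g b"
    using g \<open>a \<le> b\<close> by (auto simp: mono_on_def)
  have split: "integral {a..b} K = integral {a..c} K + integral {c..b} K"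
    using c K by (intro Henstock_Kurzweil_Integration.integral_combine[symmetric]) auto
  have "integral {a..b} (\<lambda>t. g t * K t) = g a * integral {a..b} K + (g b - g a) * integral {c..b} K"
    unfolding eq split by (simp add: algebra_simps)
  also have "\<bar>\<dots>\<bar> \<le> g a * \<bar>integral {a..b} K\<bar> + (g b - g a) * \<bar>integral {c..b} K\<bar>"
    using \<open>g a \<le> g b\<close> \<open>0 \<le> g a\<close> by (intro order_trans[OF abs_triangle_ineq]) (simp add: abs_mult)
  also have "\<dots> \<le> g a * M + (g b - g a) * M"
    using \<open>g a \<le> g b\<close> \<open>0 \<le> g a\<close> M c \<open>a \<le> b\<close> by (intro add_mono mult_left_mono) auto
  finally show ?thesis by (simp add: algebra_simps)
qed

section \<open>The variation function and the Jordan decomposition\<close>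

context
  fixes f :: "real \<Rightarrow> real"
  assumes fin: "\<And>a b. a \<le> b \<Longrightarrow> total_variation f a b < \<infinity>"
begin

lemma ereal_variation_function: "a \<le> t \<Longrightarrow> ereal (variation_function f a t) = total_variation f a t"
  using fin[of a t] total_variation_nonneg[of a t f] by (auto simp: variation_function_def ereal_real)

lemma total_variation_eq_diff:
  assumes "a \<le> s" "s \<le> t"
  shows "total_variation f s t = ereal (variation_function f a t - variation_function f a s)"
proof -
  have "ereal (variation_function f a t) = ereal (variation_function f a s) + total_variation f s t"
    using assms total_variation_add[OF assms, of f] by (simp add: ereal_variation_function)
  then show ?thesis
    by (cases "total_variation f s t") auto
qed

lemma abs_diff_le_variation_function:
  assumes "a \<le> s" "s \<le> t"
  shows "\<bar>f t - f s\<bar> \<le> variation_function f a t - variation_function f a s"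
  using abs_diff_le_total_variation[OF assms(2), of f] total_variation_eq_diff[OF assms] by simp

lemma mono_variation_function_add: "mono_on {a..b} (\<lambda>t. (variation_function f a t + f t) / 2)"
proof (rule mono_onI)
  fix s t assume "s \<in> {a..b}" "t \<in> {a..b}" "s \<le> t"
  then show "(variation_function f a s + f s) / 2 \<le> (variation_function f a t + f t) / 2"
    using abs_diff_le_variation_function[of a s t] by auto
qed

lemma mono_variation_function_diff: "mono_on {a..b} (\<lambda>t. (variation_function f a t - f t) / 2)"
proof (rule mono_onI)
  fix s t assume "s \<in> {a..b}" "t \<in> {a..b}" "s \<le> t"
  then show "(variation_function f a s - f s) / 2 \<le> (variation_function f a t - f t) / 2"
    using abs_diff_le_variation_function[of a s t] by auto
qed

lemma continuous_times_bounded_variation_integrable: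
  assumes "continuous_on {a..b} K"
  shows "(\<lambda>t. K t * f t) integrable_on {a..b}"
proof -
  have K: "K integrable_on {a..b}"
    using assms by (rule integrable_continuous_interval)
  have "(\<lambda>t. (variation_function f a t + f t) / 2 * K t - (variation_function f a t - f t) / 2 * K t)
      integrable_on {a..b}"
    using K by (intro integrable_diff increasing_times_integrable mono_variation_function_add
        mono_variation_function_diff)
  then show ?thesis
    by (rule integrable_eq) (simp add: field_simps)
qed

end

subsection \<open>One-sided limits of monotone functions\<close>

lemma mono_on_tendsto_at_right:
  fixes g :: "real \<Rightarrow> real"
  assumes g: "mono_on {a..b} g" and "a \<le> x" "x < b"
  obtains L where "(g \<longlongrightarrow> L) (at_right x)" "g x \<le> L" "\<And>t. x < t \<Longrightarrow> t \<le> b \<Longrightarrow> L \<le> g t"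
proof
  let ?L = "Inf (g ` ({x<..} \<inter> {..<b}))"
  have ge: "g x \<le> g t" if "x < t" "t \<le> b" for t
    using that assms by (auto intro: mono_onD)
  \<comment> \<open>Monotonicity is known only up to \<open>b\<close>; cutting the right
    neighbourhood at \<open>b\<close> leaves the filter unchanged.\<close>
  have "at x within ({x<..} \<inter> {..<b}) = at_right x"
    using \<open>x < b\<close> by (intro at_within_nhd[of x "{..<b}"]) auto
  moreover have "(g \<longlongrightarrow> ?L) (at x within ({x<..} \<inter> {..<b}))"
    using ge assms by (intro Lim_right_bound[of _ _ _ "g x"]) (auto intro: mono_onD[OF g])
  ultimately show lim: "(g \<longlongrightarrow> ?L) (at_right x)" by simp
  show "g x \<le> ?L"
    using ge \<open>x < b\<close> dense[of x b] by (intro cINF_greatest) auto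
  show "?L \<le> g t" if "x < t" "t \<le> b" for t
  proof (rule tendsto_upperbound[OF lim])
    show "\<forall>\<^sub>F s in at_right x. g s \<le> g t"
      using that assms by (auto simp: eventually_at_right intro!: exI[of _ t] mono_onD[OF g])
  qed simp
qed

text \<open>The map sending t to \<open>- g (- t)\<close> is again increasing and exchanges left and
  right limits.\<close>

lemma mono_on_tendsto_at_left:
  fixes g :: "real \<Rightarrow> real"
  assumes g: "mono_on {a..b} g" and "a < x" "x \<le> b"
  obtains L where "(g \<longlongrightarrow> L) (at_left x)" "L \<le> g x" "\<And>t. a \<le> t \<Longrightarrow> t < x \<Longrightarrow> g t \<le> L"
proof -
  have "mono_on {-b..-a} (\<lambda>t. - g (- t))"
    using g by (auto simp: mono_on_def)
  then obtain L where L: "((\<lambda>t. - g (- t)) \<longlongrightarrow> L) (at_right (- x))" "- g x \<le> L"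
    "\<And>t. - x < t \<Longrightarrow> t \<le> - a \<Longrightarrow> L \<le> - g (- t)"
    using assms(2,3) by (rule_tac mono_on_tendsto_at_right[of "-b" "-a" "\<lambda>t. - g (- t)" "-x"]) auto
  have "(g \<longlongrightarrow> - L) (at_left x)"
    using tendsto_minus[OF L(1)] by (simp add: filterlim_at_left_to_right)
  then show ?thesis
    using L(2) L(3)[of "- _"] by (intro that[of "- L"]) (auto simp: le_minus_iff)
qed

subsection \<open>Dirichlet kernels\<close>

lemma continuous_dirichlet_kernel: "continuous_on S (dirichlet_kernel n)"
  unfolding dirichlet_kernel_def by (intro continuous_intros)

lemma continuous_modified_dirichlet_kernel: "continuous_on S (modified_dirichlet_kernel n)"
  unfolding modified_dirichlet_kernel_def by (intro continuous_intros)

lemma dirichlet_kernel_minus: "dirichlet_kernel n (- t) = dirichlet_kernel n t"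
  by (simp add: dirichlet_kernel_def)

lemma dirichlet_kernel_periodic: "dirichlet_kernel n (t + 2 * pi) = dirichlet_kernel n t"
proof -
  have "cos (real k * (t + 2 * pi)) = cos (real k * t)" for k
    using cos.plus_of_nat[of "real k * t" k] by (simp add: algebra_simps)
  then show ?thesis by (simp add: dirichlet_kernel_def)
qed

lemma dirichlet_kernel_eq_modified:
  assumes "n \<ge> 1"
  shows "dirichlet_kernel n t = modified_dirichlet_kernel n t + cos (real n * t) / 2"
proof -
  have "{1..n} = insert n {1..<n}" using assms by auto
  then show ?thesis by (simp add: dirichlet_kernel_def modified_dirichlet_kernel_def)
qed

text \<open>Passing from n to n + 1 adds the mean of cos(nt) and cos((n + 1)t) to the kernel. With
  \<open>m\<close> the midpoint of the two arguments this mean is cos(m) cos(t/2), which carries the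
  factor needed for the induction. The product form also covers the zeros of sin(t/2).\<close>

lemma modified_dirichlet_kernel_sin:
  assumes "n \<ge> 1"
  shows "2 * sin (t / 2) * modified_dirichlet_kernel n t = sin (real n * t) * cos (t / 2)"
  using assms
proof (induction n rule: nat_induct_at_least)
  case base
  have eq: "sin t = 2 * sin (t / 2) * cos (t / 2)" "cos t = 2 * (cos (t / 2))\<^sup>2 - 1"
    using sin_double[of "t / 2"] cos_double_cos[of "t / 2"] by simp_all
  then show ?case by (simp add: modified_dirichlet_kernel_def eq power2_eq_square algebra_simps)
next
  case (Suc n)
  define m where "m = (real n + 1 / 2) * t"
  have arg: "real n * t = m - t / 2" "real (Suc n) * t = m + t / 2"
    by (simp_all add: m_def algebra_simps)
  have "{1..<Suc n} = insert n {1..<n}" using Suc by auto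
  then have "modified_dirichlet_kernel (Suc n) t
      = modified_dirichlet_kernel n t + (cos (m - t / 2) + cos (m + t / 2)) / 2"
    by (simp add: modified_dirichlet_kernel_def add_divide_distrib flip: arg)
  also have "\<dots> = modified_dirichlet_kernel n t + cos m * cos (t / 2)"
    by (simp add: cos_add cos_diff)
  finally have "2 * sin (t / 2) * modified_dirichlet_kernel (Suc n) t
      = sin (m - t / 2) * cos (t / 2) + 2 * sin (t / 2) * cos m * cos (t / 2)"
    using Suc.IH unfolding arg(1) by (simp add: algebra_simps)
  also have "\<dots> = sin (m + t / 2) * cos (t / 2)"
    by (simp add: sin_add sin_diff algebra_simps)
  finally show ?case by (simp only: arg(2))
qed

lemma modified_dirichlet_kernel_cot:
  assumes "n \<ge> 1" "sin (t / 2) \<noteq> 0"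
  shows "modified_dirichlet_kernel n t = cot (t / 2) / 2 * sin (real n * t)"
  using modified_dirichlet_kernel_sin[OF assms(1), of t] assms(2)
  by (simp add: cot_def field_simps)

lemma integral_sin_mult:
  assumes "n \<ge> 1" "a \<le> b"
  shows "integral {a..b} (\<lambda>t. sin (real n * t)) = (cos (real n * a) - cos (real n * b)) / real n"
proof -
  have "((\<lambda>t. sin (real n * t)) has_integral (- cos (real n * b) / real n) - (- cos (real n * a) / real n)) {a..b}"
    using assms by (intro fundamental_theorem_of_calculus)
      (auto intro!: derivative_eq_intros simp flip: has_real_derivative_iff_has_vector_derivative)
  then show ?thesis by (simp add: integral_unique diff_divide_distrib)
qed

lemma has_integral_cos_mult:
  assumes "n \<ge> 1" "a \<le> b"
  shows "((\<lambda>t. cos (real n * t)) has_integral (sin (real n * b) - sin (real n * a)) / real n) {a..b}"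
proof -
  have "((\<lambda>t. cos (real n * t)) has_integral sin (real n * b) / real n - sin (real n * a) / real n) {a..b}"
    using assms by (intro fundamental_theorem_of_calculus)
      (auto intro!: derivative_eq_intros simp flip: has_real_derivative_iff_has_vector_derivative)
  then show ?thesis by (simp add: diff_divide_distrib)
qed

text \<open>The cosines integrate to sines that vanish at both ends. After division by
  \<open>pi\<close>, this value gives each one-sided limit of f the weight 1/2.\<close>

lemma integral_dirichlet_kernel: "integral {0..pi} (dirichlet_kernel n) = pi / 2"
proof -
  have "(dirichlet_kernel n has_integral (pi - 0) * (1 / 2) + (\<Sum>k=1..n. (sin (real k * pi) - sin (real k * 0)) / real k)) {0..pi}"
    unfolding dirichlet_kernel_def
    by (intro has_integral_add has_integral_sum has_integral_cos_mult)
      (use has_integral_const_real[of "1 / 2 :: real" 0 pi] in auto)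
  then show ?thesis by (simp add: integral_unique)
qed

lemma cot_antimono:
  assumes "0 < s" "s \<le> t" "t \<le> pi / 2"
  shows "cot t \<le> cot s"
  unfolding cot_def using assms
  by (intro frac_le cos_monotone_0_pi_le sin_monotone_2pi_le sin_gt_zero cos_ge_zero) auto

lemma integral_modified_dirichlet_kernel_tail:
  assumes "n \<ge> 1" "0 < \<delta>" "\<delta> \<le> c" "c \<le> pi"
  shows "\<bar>integral {c..pi} (modified_dirichlet_kernel n)\<bar> \<le> cot (\<delta> / 2) / real n"
proof -
  \<comment> \<open>The cotangent decreases, so its negative is fed to the second mean value
    theorem. As cot(\<pi>/2) = 0, only the term at the left endpoint survives.\<close>
  let ?g = "\<lambda>t. - cot (t / 2) / 2"
  have "integral {c..pi} (modified_dirichlet_kernel n) = integral {c..pi} (\<lambda>t. - (?g t * sin (real n * t)))"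
  proof (rule integral_cong)
    fix t assume "t \<in> {c..pi}"
    then have "sin (t / 2) > 0" using assms by (intro sin_gt_zero) auto
    then show "modified_dirichlet_kernel n t = - (?g t * sin (real n * t))"
      using modified_dirichlet_kernel_cot[OF assms(1), of t] by simp
  qed
  moreover obtain d where d: "d \<in> {c..pi}"
    and "integral {c..pi} (\<lambda>t. ?g t * sin (real n * t))
      = ?g c * integral {c..d} (\<lambda>t. sin (real n * t)) + ?g pi * integral {d..pi} (\<lambda>t. sin (real n * t))"
  proof (rule second_mean_value_theorem[of "\<lambda>t. sin (real n * t)" c pi ?g])
    show "(\<lambda>t. sin (real n * t)) integrable_on {c..pi}"
      by (intro integrable_continuous_interval continuous_intros)
    show "?g s \<le> ?g t" if "c \<le> s" "s \<le> t" "t \<le> pi" for s t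
      using cot_antimono[of "s / 2" "t / 2"] that assms by simp
  qed (use assms in auto)
  moreover have "cot (pi / 2) = 0"
    by (simp add: cot_def)
  ultimately have "integral {c..pi} (modified_dirichlet_kernel n)
      = cot (c / 2) / 2 * ((cos (real n * c) - cos (real n * d)) / real n)"
    using assms d by (simp add: integral_sin_mult)
  moreover have "0 \<le> cot (c / 2)" "cot (c / 2) \<le> cot (\<delta> / 2)"
    using assms cot_antimono[of "c / 2" "pi / 2"] cot_antimono[of "\<delta> / 2" "c / 2"] \<open>cot (pi / 2) = 0\<close> by auto
  moreover have "\<bar>cos (real n * c) - cos (real n * d)\<bar> \<le> 2"
    using abs_cos_le_one[of "real n * c"] abs_cos_le_one[of "real n * d"] by linarith
  ultimately have "\<bar>integral {c..pi} (modified_dirichlet_kernel n)\<bar> \<le> cot (\<delta> / 2) / 2 * (2 / real n)"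
    by (simp only: abs_mult abs_divide) (intro mult_mono, auto intro: divide_right_mono)
  then show ?thesis by simp
qed

section \<open>Increasing functions integrated against the Dirichlet kernel\<close>

context
  fixes n :: nat and C \<delta> :: real
  assumes n: "n \<ge> 1" and \<delta>: "0 < \<delta>" "\<delta> \<le> pi"
    and C: "\<And>\<xi>. 0 \<le> \<xi> \<Longrightarrow> \<xi> \<le> pi \<Longrightarrow>
              \<bar>2 / pi * integral {0..\<xi>} (modified_dirichlet_kernel n)\<bar> \<le> C"
begin

lemma integral_increasing_times_dirichlet_bound:
  assumes h: "mono_on {0..pi} h" and "h 0 = 0"
  shows "\<bar>integral {0..pi} (\<lambda>t. h t * dirichlet_kernel n t)\<bar>
           \<le> C * pi * h \<delta> + (cot (\<delta> / 2) + 1 / 2) / real n * h pi"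
proof -
  let ?D = "modified_dirichlet_kernel n"
  have D: "?D integrable_on {a..b}" for a b
    by (intro integrable_continuous_interval continuous_modified_dirichlet_kernel)
  have cos: "(\<lambda>t. cos (real n * t)) integrable_on {a..b}" for a b
    by (intro integrable_continuous_interval continuous_intros)
  have h1: "mono_on {0..\<delta>} h" "mono_on {\<delta>..pi} h" "0 \<le> h \<delta>"
    using h \<delta> \<open>h 0 = 0\<close> by (auto intro: mono_on_subset dest: mono_onD[of _ _ 0 \<delta>])
  have hD: "(\<lambda>t. h t * ?D t) integrable_on {0..pi}" "(\<lambda>t. h t * cos (real n * t)) integrable_on {0..pi}"
    using h D cos by (auto intro: increasing_times_integrable)
  \<comment> \<open>The hypothesis controls integrals starting at 0. An integral over [c, \<delta>]
    is a difference of two of these, so the bound doubles to \<open>C * pi\<close> below.\<close>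
  have head: "\<bar>integral {0..\<xi>} ?D\<bar> \<le> C * pi / 2" if "0 \<le> \<xi>" "\<xi> \<le> pi" for \<xi>
    using C[OF that] by (simp add: abs_mult field_simps)
  have bounds: "\<bar>integral {0..\<delta>} (\<lambda>t. h t * ?D t)\<bar> \<le> h \<delta> * (C * pi)"
    "\<bar>integral {\<delta>..pi} (\<lambda>t. h t * ?D t)\<bar> \<le> h pi * (cot (\<delta> / 2) / real n)"
    "\<bar>integral {0..pi} (\<lambda>t. h t * cos (real n * t))\<bar> \<le> h pi * (1 / real n)"
  proof -
    show "\<bar>integral {0..\<delta>} (\<lambda>t. h t * ?D t)\<bar> \<le> h \<delta> * (C * pi)"
    proof (rule integral_increasing_times_bound)
      fix c assume c: "0 \<le> c" "c \<le> \<delta>"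
      then have "integral {0..c} ?D + integral {c..\<delta>} ?D = integral {0..\<delta>} ?D"
        using D by (intro Henstock_Kurzweil_Integration.integral_combine) auto
      then show "\<bar>integral {c..\<delta>} ?D\<bar> \<le> C * pi"
        using head[of c] head[of \<delta>] c \<delta> by linarith
    qed (use D h1 \<delta> \<open>h 0 = 0\<close> in auto)
    show "\<bar>integral {\<delta>..pi} (\<lambda>t. h t * ?D t)\<bar> \<le> h pi * (cot (\<delta> / 2) / real n)"
      using D h1 \<delta> n by (intro integral_increasing_times_bound integral_modified_dirichlet_kernel_tail) auto
    show "\<bar>integral {0..pi} (\<lambda>t. h t * cos (real n * t))\<bar> \<le> h pi * (1 / real n)"
    proof (rule integral_increasing_times_bound)
      fix c :: real assume "0 \<le> c" "c \<le> pi"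
      then have "integral {c..pi} (\<lambda>t. cos (real n * t)) = - sin (real n * c) / real n"
        using has_integral_cos_mult[OF n, of c pi] by (simp add: integral_unique)
      then show "\<bar>integral {c..pi} (\<lambda>t. cos (real n * t))\<bar> \<le> 1 / real n"
        using abs_sin_le_one[of "real n * c"] by (simp add: divide_right_mono)
    qed (use h cos \<open>h 0 = 0\<close> in auto)
  qed
  have "integral {0..\<delta>} (\<lambda>t. h t * ?D t) + integral {\<delta>..pi} (\<lambda>t. h t * ?D t)
      = integral {0..pi} (\<lambda>t. h t * ?D t)"
    using hD \<delta> by (intro Henstock_Kurzweil_Integration.integral_combine) auto
  moreover have "integral {0..pi} (\<lambda>t. h t * dirichlet_kernel n t)
      = integral {0..pi} (\<lambda>t. h t * ?D t) + integral {0..pi} (\<lambda>t. h t * cos (real n * t)) / 2"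
    using hD by (subst integral_divide[symmetric], subst integral_add[symmetric])
      (auto simp: dirichlet_kernel_eq_modified[OF n] distrib_left)
  ultimately have "\<bar>integral {0..pi} (\<lambda>t. h t * dirichlet_kernel n t)\<bar>
      \<le> \<bar>integral {0..\<delta>} (\<lambda>t. h t * ?D t)\<bar> + \<bar>integral {\<delta>..pi} (\<lambda>t. h t * ?D t)\<bar>
        + \<bar>integral {0..pi} (\<lambda>t. h t * cos (real n * t))\<bar> / 2"
    by linarith
  also have "\<dots> \<le> h \<delta> * (C * pi) + h pi * (cot (\<delta> / 2) / real n) + h pi * (1 / real n) / 2"
    using bounds by (intro add_mono divide_right_mono) auto
  finally show ?thesis by (simp add: algebra_simps add_divide_distrib)
qed

text \<open>Meant for \<open>p\<close> and \<open>q\<close> the limits of \<open>P\<close> and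
  \<open>Q\<close> at 0 from the right. Subtracting them and inserting the value 0 at 0 gives
  increasing functions on the closed interval to which the previous bound applies; the constant
  \<open>p - q\<close> contributes exactly \<open>pi / 2 * (p - q)\<close>.\<close>

lemma integral_dirichlet_difference_bound:
  assumes P: "mono_on {0<..pi} P" "\<And>t. 0 < t \<Longrightarrow> t \<le> pi \<Longrightarrow> p \<le> P t"
    and Q: "mono_on {0<..pi} Q" "\<And>t. 0 < t \<Longrightarrow> t \<le> pi \<Longrightarrow> q \<le> Q t"
    and F: "\<And>t. 0 < t \<Longrightarrow> t \<le> pi \<Longrightarrow> F t = P t - Q t"
  shows "\<bar>integral {0..pi} (\<lambda>t. dirichlet_kernel n t * F t) - pi / 2 * (p - q)\<bar>
           \<le> C * pi * ((P \<delta> + Q \<delta>) - (p + q))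
             + (cot (\<delta> / 2) + 1 / 2) / real n * ((P pi + Q pi) - (p + q))"
proof -
  let ?D = "dirichlet_kernel n"
  define g h where "g t = (if t = 0 then 0 else P t - p)" and "h t = (if t = 0 then 0 else Q t - q)" for t
  have mono: "mono_on {0..pi} g" "mono_on {0..pi} h"
    using P Q by (auto simp: g_def h_def mono_on_def)
  have D: "?D integrable_on {0..pi}"
    by (intro integrable_continuous_interval continuous_dirichlet_kernel)
  note int = increasing_times_integrable[OF D mono(1)] increasing_times_integrable[OF D mono(2)]
  \<comment> \<open>Nothing is known about \<open>F 0\<close>, but a single point does not affect
    the integral.\<close>
  have "integral {0..pi} (\<lambda>t. ?D t * F t)
      = integral {0..pi} (\<lambda>t. g t * ?D t - h t * ?D t + (p - q) * ?D t)"
    by (rule integral_spike[of "{0}"]) (auto simp: g_def h_def F algebra_simps)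
  also have "\<dots> = integral {0..pi} (\<lambda>t. g t * ?D t) - integral {0..pi} (\<lambda>t. h t * ?D t) + (p - q) * (pi / 2)"
    using int D by (subst integral_add, auto intro: integrable_diff integrable_on_mult_right)
      (simp add: integral_diff integral_dirichlet_kernel)
  finally have eq: "integral {0..pi} (\<lambda>t. ?D t * F t) - pi / 2 * (p - q)
      = integral {0..pi} (\<lambda>t. g t * ?D t) - integral {0..pi} (\<lambda>t. h t * ?D t)"
    by (simp add: algebra_simps)
  have "\<bar>integral {0..pi} (\<lambda>t. g t * ?D t)\<bar> \<le> C * pi * g \<delta> + (cot (\<delta> / 2) + 1 / 2) / real n * g pi"
    "\<bar>integral {0..pi} (\<lambda>t. h t * ?D t)\<bar> \<le> C * pi * h \<delta> + (cot (\<delta> / 2) + 1 / 2) / real n * h pi"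
    by (intro integral_increasing_times_dirichlet_bound mono; simp add: g_def h_def)+
  moreover have "C * pi * (g \<delta> + h \<delta>) + (cot (\<delta> / 2) + 1 / 2) / real n * (g pi + h pi)
     = C * pi * ((P \<delta> + Q \<delta>) - (p + q))
             + (cot (\<delta> / 2) + 1 / 2) / real n * ((P pi + Q pi) - (p + q))"
    using \<delta> by (simp add: g_def h_def algebra_simps)
  ultimately show ?thesis
    unfolding eq by (simp only: distrib_left)
qed

end

text \<open>By periodicity the integral may be taken over the period centred at \<open>x\<close>. It
  is split at \<open>x\<close>, and evenness of the kernel turns both halves into integrals over
  [0, \<pi>].\<close>

lemma fourier_partial_sum_eq:
  assumes per: "\<And>t. f (t + 2 * pi) = f t"
    and fin: "\<And>a b. a \<le> b \<Longrightarrow> total_variation f a b < \<infinity>"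
  shows "fourier_partial_sum n f x = 1 / pi *
    (integral {0..pi} (\<lambda>t. dirichlet_kernel n t * f (x + t))
      + integral {0..pi} (\<lambda>t. dirichlet_kernel n t * f (x - t)))"
proof -
  let ?D = "dirichlet_kernel n" and ?F = "\<lambda>t. dirichlet_kernel n (x - t) * f t"
  have int: "?F integrable_on {a..b}" for a b
    by (intro continuous_times_bounded_variation_integrable[OF fin] continuous_on_compose2[OF continuous_dirichlet_kernel[of UNIV]]
        continuous_intros) auto
  have Fper: "?F (t + 2 * pi) = ?F t" for t
    using dirichlet_kernel_periodic[of n "x - (t + 2 * pi)"] by (simp add: per)
  have add: "integral {a..c} ?F = integral {a..b} ?F + integral {b..c} ?F" if "a \<le> b" "b \<le> c" for a b c
    using that int by (intro Henstock_Kurzweil_Integration.integral_combine[symmetric])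
  have shift: "integral {a + 2 * pi..b + 2 * pi} ?F = integral {a..b} ?F" for a b
    using integral_shift_real_ivl[of "a + 2 * pi" "2 * pi" "b + 2 * pi" ?F] by (simp add: Fper)
  have "integral {- pi..- pi + 2 * pi} ?F = integral {x - pi..x - pi + 2 * pi} ?F"
    by (rule periodic_additive_interval_function[where Q = "\<lambda>a b. integral {a..b} ?F" and p = "2 * pi"])
      (fact add, fact shift, simp)
  then have "integral {- pi..pi} ?F = integral {x - pi..x + pi} ?F"
    by (simp add: algebra_simps)
  also have "\<dots> = integral {x - pi..x} ?F + integral {x..x + pi} ?F"
    by (intro add) auto
  also have "integral {x..x + pi} ?F = integral {0..pi} (\<lambda>t. ?D t * f (x + t))"
    using integral_shift_real_ivl[of x x "x + pi" ?F] by (simp add: dirichlet_kernel_minus add.commute)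
  \<comment> \<open>The unsimplified \<open>-0\<close> and \<open>x - - t\<close> exhibit the shape
    required by the reflection rule.\<close>
  also have "integral {x - pi..x} ?F = integral {-pi..-0} (\<lambda>t. ?D (- t) * f (x - - t))"
    using integral_shift_real_ivl[of "x - pi" x x ?F] by (simp add: add.commute)
  also have "\<dots> = integral {0..pi} (\<lambda>t. ?D t * f (x - t))"
    by (rule Henstock_Kurzweil_Integration.integral_reflect_real)
  finally show ?thesis by (simp add: fourier_partial_sum_def add.commute)
qed

section \<open>Assembling the estimates on both sides of \<open>x\<close>\<close>

theorem theorem6p11:
  fixes B x C :: real and \<omega> :: "real \<Rightarrow> real"
  assumes "B > 0"
    and "modulus_bounding \<omega>"
    and "C > 0"
    and "\<And>(n::nat) \<xi>. n \<ge> 1 \<Longrightarrow> 0 \<le> \<xi> \<Longrightarrow> \<xi> \<le> pi \<Longrightarrow>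
           \<bar>2 / pi * integral {0..\<xi>} (modified_dirichlet_kernel n)\<bar> \<le> C"
  shows "\<forall>f \<in> BV1 B x \<omega>. \<forall>\<delta>. 0 < \<delta> \<and> \<delta> \<le> pi \<longrightarrow> (\<forall>n::nat. n \<ge> 1 \<longrightarrow>
           \<bar>fourier_partial_sum n f x - 1 / 2 * (Lim (at_right x) f + Lim (at_left x) f)\<bar>
             \<le> 2 * B / (pi * real n) * (1 + 6 * cot (\<delta> / 2)) + 8 * C * \<omega> \<delta>)"
proof (intro ballI allI impI, elim conjE)
  fix f \<delta> and n :: nat
  assume f: "f \<in> BV1 B x \<omega>" and \<delta>: "0 < \<delta>" "\<delta> \<le> pi" and n: "n \<ge> 1"
  let ?a = "x - 2 * pi" and ?b = "x + 2 * pi" and ?D = "dirichlet_kernel n"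
  define v where "v = variation_function f ?a"
  define u w where "u t = (v t + f t) / 2" and "w t = (v t - f t) / 2" for t
  have per: "f (t + 2 * pi) = f t" and B: "total_variation f (- pi) pi \<le> ereal B" for t
    using f by (auto simp: BV1_def)
  have "total_variation f (- pi) pi < \<infinity>"
    using B by (rule le_less_trans) simp
  then have fin: "total_variation f a b < \<infinity>" if "a \<le> b" for a b
    using total_variation_periodic_finite[of f "2 * pi" "- pi" a b] per that by simp
  have mono: "mono_on {?a..?b} u" "mono_on {?a..?b} w"
    using mono_variation_function_add[OF fin, of ?a ?b] mono_variation_function_diff[OF fin, of ?a ?b]
    by (simp_all add: u_def[abs_def] w_def[abs_def] v_def)
  have v_eq: "v = (\<lambda>t. u t + w t)" and f_eq: "f = (\<lambda>t. u t - w t)"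
    by (auto simp: u_def w_def field_simps)
  note v_at = fun_cong[OF v_eq] and f_at = fun_cong[OF f_eq]
  obtain ur where ur: "(u \<longlongrightarrow> ur) (at_right x)" "u x \<le> ur" "\<And>t. x < t \<Longrightarrow> t \<le> ?b \<Longrightarrow> ur \<le> u t"
    using mono_on_tendsto_at_right[OF mono(1), of x] by auto
  obtain wr where wr: "(w \<longlongrightarrow> wr) (at_right x)" "w x \<le> wr" "\<And>t. x < t \<Longrightarrow> t \<le> ?b \<Longrightarrow> wr \<le> w t"
    using mono_on_tendsto_at_right[OF mono(2), of x] by auto
  obtain ul where ul: "(u \<longlongrightarrow> ul) (at_left x)" "ul \<le> u x" "\<And>t. ?a \<le> t \<Longrightarrow> t < x \<Longrightarrow> u t \<le> ul"
    using mono_on_tendsto_at_left[OF mono(1), of x] by auto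
  obtain wl where wl: "(w \<longlongrightarrow> wl) (at_left x)" "wl \<le> w x" "\<And>t. ?a \<le> t \<Longrightarrow> t < x \<Longrightarrow> w t \<le> wl"
    using mono_on_tendsto_at_left[OF mono(2), of x] by auto
  \<comment> \<open>\<open>Lim\<close> is informative only once the limits exist; the monotone parts
    \<open>u\<close> and \<open>w\<close> supply them.\<close>
  have Lim: "Lim (at_right x) v = ur + wr" "Lim (at_left x) v = ul + wl"
    "Lim (at_right x) f = ur - wr" "Lim (at_left x) f = ul - wl"
    unfolding v_eq by (subst f_eq | intro tendsto_Lim tendsto_add tendsto_diff ur wr ul wl; simp)+
  have v_mono: "v s \<le> v t" if "?a \<le> s" "s \<le> t" "t \<le> ?b" for s t
    using mono_onD[OF mono(1), of s t] mono_onD[OF mono(2), of s t] that by (simp add: v_at)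
  \<comment> \<open>A real supremum dominates the members of its set only if the set is bounded
    above, so this comes before the value at \<open>x + \<delta>\<close> is compared with the
    quasi-modulus.\<close>
  have "bdd_above ((\<lambda>t. \<bar>Lim (at_right x) v - v t\<bar>) ` {x<..x + \<delta>})"
  proof (rule bdd_aboveI2)
    fix t assume t: "t \<in> {x<..x + \<delta>}"
    then show "\<bar>Lim (at_right x) v - v t\<bar> \<le> v (x + \<delta>) - Lim (at_right x) v"
      using ur(3)[of t] wr(3)[of t] v_mono[of t "x + \<delta>"] \<delta> by (auto simp: Lim v_at)
  qed
  then have "\<bar>Lim (at_right x) v - v (x + \<delta>)\<bar> \<le> right_quasi_modulus v x \<delta>"
    unfolding right_quasi_modulus_def using \<delta> by (intro cSUP_upper) auto
  also have "\<dots> \<le> \<omega> \<delta>"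
    using f \<delta> by (auto simp: BV1_def v_def)
  finally have right: "v (x + \<delta>) - (ur + wr) \<le> \<omega> \<delta>"
    by (simp add: Lim)
  have "bdd_above ((\<lambda>t. \<bar>Lim (at_left x) v - v t\<bar>) ` {x - \<delta>..<x})"
  proof (rule bdd_aboveI2)
    fix t assume t: "t \<in> {x - \<delta>..<x}"
    then show "\<bar>Lim (at_left x) v - v t\<bar> \<le> Lim (at_left x) v - v (x - \<delta>)"
      using ul(3)[of t] wl(3)[of t] v_mono[of "x - \<delta>" t] \<delta> by (auto simp: Lim v_at)
  qed
  then have "\<bar>Lim (at_left x) v - v (x - \<delta>)\<bar> \<le> left_quasi_modulus v x \<delta>"
    unfolding left_quasi_modulus_def using \<delta> by (intro cSUP_upper) auto
  also have "\<dots> \<le> \<omega> \<delta>"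
    using f \<delta> by (auto simp: BV1_def v_def)
  finally have left: "(ul + wl) - v (x - \<delta>) \<le> \<omega> \<delta>"
    by (simp add: Lim)
  have "ereal (v (x + pi) - v (x - pi)) = total_variation f (x - pi) (x + pi)"
    unfolding v_def by (rule total_variation_eq_diff[OF fin, symmetric]) auto
  also have "\<dots> = total_variation f (- pi) pi"
    using total_variation_period[of f "2 * pi" "x - pi" "- pi"] per by (simp add: add.commute)
  finally have vB: "v (x + pi) - v (x - pi) \<le> B"
    using B by (metis ereal_less_eq(3))

  define E where "E = (cot (\<delta> / 2) + 1 / 2) / real n"
  have "cot (\<delta> / 2) \<ge> 0"
    using \<delta> by (auto simp: cot_def intro!: divide_nonneg_nonneg cos_ge_zero sin_ge_zero)
  then have "E \<ge> 0" by (simp add: E_def)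
  note bound = integral_dirichlet_difference_bound[OF n \<delta> assms(4)[OF n], folded E_def]
  have R: "\<bar>integral {0..pi} (\<lambda>t. ?D t * f (x + t)) - pi / 2 * (ur - wr)\<bar>
      \<le> C * pi * ((u (x + \<delta>) + w (x + \<delta>)) - (ur + wr)) + E * ((u (x + pi) + w (x + pi)) - (ur + wr))"
  proof (rule bound)
    show "mono_on {0<..pi} (\<lambda>t. u (x + t))" "mono_on {0<..pi} (\<lambda>t. w (x + t))"
      by (auto intro!: mono_onI mono_onD[OF mono(1)] mono_onD[OF mono(2)])
  qed (use ur wr in \<open>auto simp: f_at\<close>)
  \<comment> \<open>On the left of \<open>x\<close>, \<open>f(x - t) = (- w(x - t)) - (- u(x - t))\<close> is the difference of two increasing
    functions of \<open>t\<close>.\<close>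
  have L: "\<bar>integral {0..pi} (\<lambda>t. ?D t * f (x - t)) - pi / 2 * (- wl - (- ul))\<bar>
      \<le> C * pi * ((- w (x - \<delta>) + - u (x - \<delta>)) - (- wl + - ul))
         + E * ((- w (x - pi) + - u (x - pi)) - (- wl + - ul))"
  proof (rule bound)
    show "mono_on {0<..pi} (\<lambda>t. - w (x - t))" "mono_on {0<..pi} (\<lambda>t. - u (x - t))"
      by (auto intro!: mono_onI mono_onD[OF mono(1)] mono_onD[OF mono(2)])
  qed (use ul wl in \<open>auto simp: f_at\<close>)
  let ?I = "integral {0..pi} (\<lambda>t. ?D t * f (x + t))" and ?J = "integral {0..pi} (\<lambda>t. ?D t * f (x - t))"
  have "\<bar>(?I - pi / 2 * (ur - wr)) + (?J - pi / 2 * (ul - wl))\<bar>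
      \<le> C * pi * ((v (x + \<delta>) - (ur + wr)) + ((ul + wl) - v (x - \<delta>)))
        + E * ((v (x + pi) - (ur + wr)) + ((ul + wl) - v (x - pi)))"
    using R L by (simp add: v_at algebra_simps)
  \<comment> \<open>The increments at distance \<pi> sum to \<open>v (x + pi) - v (x - pi)\<close>
    minus the jump of \<open>v\<close> at \<open>x\<close>. That jump is nonnegative because
    \<open>u x\<close> and \<open>w x\<close> lie between their one-sided limits, so the sum is at
    most \<open>B\<close>.\<close>
  also have "\<dots> \<le> C * pi * (2 * \<omega> \<delta>) + E * B"
    using left right vB ur(2) wr(2) ul(2) wl(2) \<open>C > 0\<close> \<open>E \<ge> 0\<close>
    by (intro add_mono mult_left_mono) auto
  finally have "\<bar>1 / pi * ((?I - pi / 2 * (ur - wr)) + (?J - pi / 2 * (ul - wl)))\<bar>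
      \<le> 1 / pi * (C * pi * (2 * \<omega> \<delta>) + E * B)"
    by (simp add: abs_mult divide_right_mono)
  also have "1 / pi * ((?I - pi / 2 * (ur - wr)) + (?J - pi / 2 * (ul - wl)))
      = fourier_partial_sum n f x - 1 / 2 * (Lim (at_right x) f + Lim (at_left x) f)"
    by (simp add: fourier_partial_sum_eq[OF per fin] Lim field_simps)
  also have "1 / pi * (C * pi * (2 * \<omega> \<delta>) + E * B) = B / (pi * real n) * (cot (\<delta> / 2) + 1 / 2) + 2 * (C * \<omega> \<delta>)"
    using n by (simp add: E_def field_simps)
  \<comment> \<open>The constants are enlarged to those of the claim; this uses that the cotangent,
    \<open>B\<close> and \<open>C * \<omega> \<delta>\<close> are nonnegative.\<close>
  also have "\<dots> \<le> B / (pi * real n) * (2 * (1 + 6 * cot (\<delta> / 2))) + 8 * (C * \<omega> \<delta>)"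
  proof (intro add_mono mult_left_mono)
    have "0 \<le> \<omega> \<delta>"
      using assms(2) \<delta> by (simp add: modulus_bounding_def)
    then have "0 \<le> C * \<omega> \<delta>"
      using \<open>C > 0\<close> by simp
    then show "2 * (C * \<omega> \<delta>) \<le> 8 * (C * \<omega> \<delta>)"
      by simp
  qed (use \<open>cot (\<delta> / 2) \<ge> 0\<close> \<open>B > 0\<close> in auto)
  finally show "\<bar>fourier_partial_sum n f x - 1 / 2 * (Lim (at_right x) f + Lim (at_left x) f)\<bar>
      \<le> 2 * B / (pi * real n) * (1 + 6 * cot (\<delta> / 2)) + 8 * C * \<omega> \<delta>"
    by (simp add: mult_ac)
qed

end
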